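(* Let $(X,d)$ be a metric space and let $T,S:X\to X$ be mappings such that $X$ verifies the CLR$(T,S)$-property. Let $\{x_n\}_{n\ge 0}$ be a Picard sequence of the pair $(T,S)$ (based on $x_0$). Suppose that: (i) $T$ is a $\Sigma_c$-$S$-Kannan mapping with respect to some $\sigma_c\in\Sigma_c$ with $c=1$, where $\sigma_c$ satisfies either (a) $\sigma_c(t,s)<s-t$ for all $s,t>0$, or (b) the property $(\$)$; (ii) $T$ and $S$ are both continuous at a point $Sq\in X$ (where $q\in X$); (iii) the sequence $\{Tx_n\}$ has a subsequence $\{Tx_{n_k}\}$ converging to $Sq$. Then either (A) there is a coincidence point of the pair $(T,S)$; or both of the following hold: (B) if $\{x_n\}_{n\ge 0}$ is $S$-asymptotically similar with respect to $T$, then $Sq$ is a fixed point of $T$; and (B* ) if $Sq$ is a fixed point of $S$, then $Sq$ is a fixed point of $T$.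
   Context: For a real constant $c\ge 1$, a function $\sigma_c:[0,\infty)\times[0,\infty)\to\mathbb{R}$ is a $\sigma_c$-function if: ($\sigma$1) whenever $\{a_n\}\subset(0,\infty)$ is a sequence with $\sigma_c(a_n,a_{n-1}+a_n)>0$ for all $n\in\mathbb{N}$, then $a_n\to 0$; ($\sigma$2) whenever $\{a_n\},\{b_n\}\subset(0,\infty)$ are convergent sequences with $cL=\lim b_n\ge\lim a_n=L\ge 0$ and $\sigma_c(a_n,b_n)>0$ for all $n\in\mathbb{N}$, then $L=0$. The set of all such functions is denoted $\Sigma_c$. Such a function has property $(\$)$ if whenever $\{a_n\},\{b_n\}\subset(0,\infty)$ satisfy $b_n\to 0$ and $\sigma_c(a_n,b_n)>0$ for all $n$, then $a_n\to 0$. $T$ is a $\Sigma_c$-$S$-Kannan mapping with respect to $\sigma_c\in\Sigma_c$ if $\sigma_c\big(d(Tx,Ty),\,d(Tx,Sx)+d(Ty,Sy)\big)>0$ for all $x,y\in X$. A sequence $\{x_n\}_{n\ge0}\subseteq X$ is a Picard sequence of the pair $(T,S)$ (based on $x_0$) if $Sx_{n+1}=Tx_n$ for all $n\ge 0$. $X$ verifies the CLR$(T,S)$-property if there exists in $X$ a Picard sequence of $(T,S)$ based on some point $x_0$. A coincidence point of $(T,S)$ is a point $c\in X$ with $Tc=Sc$. The sequence $\{x_n\}$ is $S$-asymptotically similar with respect to $T$ if $\lim_{n\to\infty}d(TSx_n,SSx_n)=0$. *)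

theory Defs
  imports Complex_Main
begin

text \<open>
  A function on \<open>[0,\<infinity>) \<times> [0,\<infinity>)\<close> is represented by a function on all pairs of reals; every
  condition below evaluates it at nonnegative arguments only, so its values elsewhere are irrelevant.
  In the first condition, sequences are indexed from 0 and the pair \<open>(n - 1, n)\<close> is written
  \<open>(n, Suc n)\<close>.
\<close>

definition sigma1 :: "(real \<Rightarrow> real \<Rightarrow> real) \<Rightarrow> bool" where
  "sigma1 \<sigma> \<longleftrightarrow>
     (\<forall>a :: nat \<Rightarrow> real.
        (\<forall>n. a n > 0) \<and> (\<forall>n. \<sigma> (a (Suc n)) (a n + a (Suc n)) > 0) \<longrightarrow> a \<longlonglongrightarrow> 0)"

definition sigma2 :: "real \<Rightarrow> (real \<Rightarrow> real \<Rightarrow> real) \<Rightarrow> bool" where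
  "sigma2 c \<sigma> \<longleftrightarrow>
     (\<forall>(a :: nat \<Rightarrow> real) (b :: nat \<Rightarrow> real) L.
        (\<forall>n. a n > 0) \<and> (\<forall>n. b n > 0) \<and>
        b \<longlonglongrightarrow> c * L \<and> a \<longlonglongrightarrow> L \<and> c * L \<ge> L \<and> L \<ge> 0 \<and>
        (\<forall>n. \<sigma> (a n) (b n) > 0) \<longrightarrow> L = 0)"

definition Sigma_class :: "real \<Rightarrow> (real \<Rightarrow> real \<Rightarrow> real) set" where
  "Sigma_class c = {\<sigma>. c \<ge> 1 \<and> sigma1 \<sigma> \<and> sigma2 c \<sigma>}"

text \<open>The property \<open>($)\<close>.\<close>

definition dollar_property :: "(real \<Rightarrow> real \<Rightarrow> real) \<Rightarrow> bool" where
  "dollar_property \<sigma> \<longleftrightarrow>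
     (\<forall>(a :: nat \<Rightarrow> real) (b :: nat \<Rightarrow> real).
        (\<forall>n. a n > 0) \<and> (\<forall>n. b n > 0) \<and> b \<longlonglongrightarrow> 0 \<and> (\<forall>n. \<sigma> (a n) (b n) > 0)
        \<longrightarrow> a \<longlonglongrightarrow> 0)"

definition Sigma_Kannan ::
    "real \<Rightarrow> (real \<Rightarrow> real \<Rightarrow> real) \<Rightarrow> ('a::metric_space \<Rightarrow> 'a) \<Rightarrow> ('a \<Rightarrow> 'a) \<Rightarrow> bool" where
  "Sigma_Kannan c \<sigma> T S \<longleftrightarrow>
     \<sigma> \<in> Sigma_class c \<and>
     (\<forall>x y. \<sigma> (dist (T x) (T y)) (dist (T x) (S x) + dist (T y) (S y)) > 0)"

definition Picard_seq :: "('a \<Rightarrow> 'a) \<Rightarrow> ('a \<Rightarrow> 'a) \<Rightarrow> 'a \<Rightarrow> (nat \<Rightarrow> 'a) \<Rightarrow> bool" where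
  "Picard_seq T S x0 x \<longleftrightarrow> x 0 = x0 \<and> (\<forall>n. S (x (Suc n)) = T (x n))"

definition CLR_property :: "('a \<Rightarrow> 'a) \<Rightarrow> ('a \<Rightarrow> 'a) \<Rightarrow> bool" where
  "CLR_property T S \<longleftrightarrow> (\<exists>x0 x. Picard_seq T S x0 x)"

definition coincidence_point :: "('a \<Rightarrow> 'a) \<Rightarrow> ('a \<Rightarrow> 'a) \<Rightarrow> 'a \<Rightarrow> bool" where
  "coincidence_point T S z \<longleftrightarrow> T z = S z"

definition asymptotically_similar ::
    "('a::metric_space \<Rightarrow> 'a) \<Rightarrow> ('a \<Rightarrow> 'a) \<Rightarrow> (nat \<Rightarrow> 'a) \<Rightarrow> bool" where
  "asymptotically_similar T S x \<longleftrightarrow> (\<lambda>n. dist (T (S (x n))) (S (S (x n)))) \<longlonglongrightarrow> 0"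

end

theory Submission
  imports Defs
begin

text \<open>
  Assume that there is no coincidence point, so that every residual \<open>d(Tz, Sz)\<close> is positive.
  Along a Picard sequence the distance \<open>d(Tx\<^bsub>n+1\<^esub>, Tx\<^sub>n)\<close> is itself the residual at \<open>x\<^bsub>n+1\<^esub>\<close>, so
  the Kannan condition says that consecutive residuals satisfy the hypothesis of \<open>(\<sigma>1)\<close>; hence
  they tend to 0 (lemma \<open>Picard_residuals_tendsto_0\<close>).

  Now let \<open>p\<close> be a limit of a subsequence \<open>Tx\<^bsub>r k\<^esub>\<close> with \<open>Sp = p\<close>. Comparing \<open>x\<^bsub>r k\<^esub>\<close> with \<open>p\<close>, the
  first argument \<open>d(Tx\<^bsub>r k\<^esub>, Tp)\<close> of \<open>\<sigma>\<close> tends to \<open>d(p, Tp)\<close>; the second is the residual at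
  \<open>x\<^bsub>r k\<^esub>\<close> plus \<open>d(Tp, p)\<close> and, the residuals being null, tends to the same number. So
  \<open>(\<sigma>2)\<close> with \<open>c = 1\<close> forces \<open>d(p, Tp) = 0\<close>, which makes \<open>p\<close> a coincidence point after all
  (lemma \<open>coincidence_if_S_fixes_limit\<close>).

  For an asymptotically similar sequence, continuity gives a coincidence point: the points
  \<open>Sx\<^bsub>r k + 1\<^esub> = Tx\<^bsub>r k\<^esub>\<close> tend to \<open>p\<close>, so their images under \<open>T\<close> and \<open>S\<close> tend to \<open>Tp\<close> and \<open>Sp\<close>,
  and the mutual distance of these images tends to 0 (lemma
  \<open>coincidence_if_asymptotically_similar\<close>).

  Hence under the premise of either implication of the second alternative, the first alternative
  holds.
\<close>

text \<open>
  The equation \<open>Sx\<^bsub>n+1\<^esub> = Tx\<^sub>n\<close> turns the Kannan condition for the pair \<open>(x\<^bsub>n+1\<^esub>, x\<^sub>n)\<close> into a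
  statement about residuals alone, of the shape required by \<open>(\<sigma>1)\<close>; the absence of
  coincidence points supplies the positivity.
\<close>

lemma Picard_residuals_tendsto_0:
  fixes T S :: "'a::metric_space \<Rightarrow> 'a"
  assumes kannan: "Sigma_Kannan c \<sigma> T S"
    and picard: "Picard_seq T S x0 x"
    and no_coincidence: "\<And>z. \<not> coincidence_point T S z"
  shows "(\<lambda>n. dist (T (x n)) (S (x n))) \<longlonglongrightarrow> 0"
proof -
  have "dist (T (x n)) (S (x n)) > 0" for n
    using no_coincidence by (simp add: coincidence_point_def)
  moreover have "\<sigma> (dist (T (x (Suc n))) (S (x (Suc n))))
      (dist (T (x n)) (S (x n)) + dist (T (x (Suc n))) (S (x (Suc n)))) > 0" for n
  proof -
    have "\<sigma> (dist (T (x (Suc n))) (T (x n)))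
        (dist (T (x (Suc n))) (S (x (Suc n))) + dist (T (x n)) (S (x n))) > 0"
      using kannan by (simp add: Sigma_Kannan_def)
    moreover have "T (x n) = S (x (Suc n))"
      using picard by (simp add: Picard_seq_def)
    ultimately show ?thesis
      by (simp add: add.commute)
  qed
  moreover have "sigma1 \<sigma>"
    using kannan by (simp add: Sigma_Kannan_def Sigma_class_def)
  ultimately show ?thesis
    unfolding sigma1_def by (elim allE[where x = "\<lambda>n. dist (T (x n)) (S (x n))"]) simp
qed

lemma coincidence_if_asymptotically_similar:
  fixes T S :: "'a::metric_space \<Rightarrow> 'a"
  assumes picard: "Picard_seq T S x0 x"
    and similar: "asymptotically_similar T S x"
    and cont: "isCont T p" "isCont S p"
    and r: "strict_mono r"
    and lim: "(\<lambda>k. T (x (r k))) \<longlonglongrightarrow> p"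
  shows "coincidence_point T S p"
proof -
  have "(\<lambda>k. S (x (Suc (r k)))) \<longlonglongrightarrow> p"
    using lim picard by (simp add: Picard_seq_def)
  then have "(\<lambda>k. dist (T (S (x (Suc (r k))))) (S (S (x (Suc (r k)))))) \<longlonglongrightarrow> dist (T p) (S p)"
    by (intro tendsto_dist isCont_tendsto_compose[OF cont(1)] isCont_tendsto_compose[OF cont(2)])
  moreover have "(\<lambda>k. dist (T (S (x (Suc (r k))))) (S (S (x (Suc (r k)))))) \<longlonglongrightarrow> 0"
  proof -
    have "strict_mono (\<lambda>k. Suc (r k))"
      using r by (simp add: strict_mono_def)
    then show ?thesis
      using LIMSEQ_subseq_LIMSEQ[of "\<lambda>n. dist (T (S (x n))) (S (S (x n)))" 0 "\<lambda>k. Suc (r k)"]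
        similar
      by (simp add: asymptotically_similar_def o_def)
  qed
  ultimately have "dist (T p) (S p) = 0"
    by (rule LIMSEQ_unique)
  then show ?thesis
    by (simp add: coincidence_point_def)
qed

text \<open>
  The sequence \<open>y\<close> stands for a subsequence of a Picard sequence.  The condition
  \<open>Sp = p\<close> makes the residual at \<open>p\<close> equal to the limit \<open>d(p, Tp)\<close> of the first arguments, which
  is why \<open>(\<sigma>2)\<close> is used with \<open>c = 1\<close>.
\<close>

lemma coincidence_if_S_fixes_limit:
  fixes T S :: "'a::metric_space \<Rightarrow> 'a"
  assumes kannan: "Sigma_Kannan 1 \<sigma> T S"
    and residuals: "(\<lambda>n. dist (T (y n)) (S (y n))) \<longlonglongrightarrow> 0"
    and lim: "(\<lambda>n. T (y n)) \<longlonglongrightarrow> p"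
    and fixed: "S p = p"
  shows "coincidence_point T S p"
proof (rule ccontr)
  assume "\<not> coincidence_point T S p"
  then have pos: "dist p (T p) > 0"
    using fixed by (auto simp: coincidence_point_def)
  define a where "a n = dist (T (y n)) (T p)" for n
  define b where "b n = dist (T (y n)) (S (y n)) + dist (T p) (S p)" for n
  have a_lim: "a \<longlonglongrightarrow> dist p (T p)"
    unfolding a_def by (intro tendsto_intros lim)
  have b_lim: "b \<longlonglongrightarrow> dist p (T p)"
    unfolding b_def fixed using tendsto_add[OF residuals tendsto_const[of "dist (T p) p"]]
    by (simp add: dist_commute)
  \<comment> \<open>The sequences in \<open>(\<sigma>2)\<close> have positive terms, but \<open>T (y n) = T p\<close> is possible for small \<open>n\<close>;
      the positive limit permits passing to a tail.\<close>
  obtain N where N: "\<And>n. n \<ge> N \<Longrightarrow> a n > 0"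
    using order_tendstoD(1)[OF a_lim pos] by (auto simp: eventually_sequentially)
  have "a (n + N) > 0" for n
    by (simp add: N)
  moreover have "b (n + N) > 0" for n
    unfolding b_def fixed using pos by (simp add: add_nonneg_pos dist_commute)
  moreover have "\<sigma> (a (n + N)) (b (n + N)) > 0" for n
    using kannan by (simp add: Sigma_Kannan_def a_def b_def)
  moreover have "(\<lambda>n. a (n + N)) \<longlonglongrightarrow> dist p (T p)" "(\<lambda>n. b (n + N)) \<longlonglongrightarrow> 1 * dist p (T p)"
    using LIMSEQ_ignore_initial_segment[OF a_lim] LIMSEQ_ignore_initial_segment[OF b_lim]
    by simp_all
  moreover have "1 * dist p (T p) \<ge> dist p (T p)" "dist p (T p) \<ge> 0"
    by simp_all
  moreover have "sigma2 1 \<sigma>"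
    using kannan by (simp add: Sigma_Kannan_def Sigma_class_def)
  ultimately have "dist p (T p) = 0"
    unfolding sigma2_def
    by (elim allE[where x = "\<lambda>n. a (n + N)"] allE[where x = "\<lambda>n. b (n + N)"]
          allE[where x = "dist p (T p)"]) simp
  with pos show False
    by simp
qed

theorem theorem3p17:
  fixes T S :: "'a::metric_space \<Rightarrow> 'a"
    and x :: "nat \<Rightarrow> 'a"
    and x0 q :: 'a
    and \<sigma> :: "real \<Rightarrow> real \<Rightarrow> real"
    and c :: real
    and r :: "nat \<Rightarrow> nat"
  assumes "CLR_property T S"
    and "Picard_seq T S x0 x"
    and "c = 1"
    and "Sigma_Kannan c \<sigma> T S"
    and "(\<forall>s t. s > 0 \<and> t > 0 \<longrightarrow> \<sigma> t s < s - t) \<or> dollar_property \<sigma>"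
    and "isCont T (S q)"
    and "isCont S (S q)"
    and "strict_mono r"
    and "(\<lambda>k. T (x (r k))) \<longlonglongrightarrow> S q"
  shows "(\<exists>z. coincidence_point T S z) \<or>
         ((asymptotically_similar T S x \<longrightarrow> T (S q) = S q) \<and>
          (S (S q) = S q \<longrightarrow> T (S q) = S q))"
proof (cases "\<exists>z. coincidence_point T S z")
  case True
  then show ?thesis ..
next
  case False
  have "\<not> asymptotically_similar T S x"
    using coincidence_if_asymptotically_similar[OF assms(2) _ assms(6-9)] False by blast
  moreover have "S (S q) \<noteq> S q"
  proof
    assume "S (S q) = S q"
    have kannan: "Sigma_Kannan 1 \<sigma> T S"
      using assms(3,4) by simp
    have "(\<lambda>n. dist (T (x n)) (S (x n))) \<longlonglongrightarrow> 0"
      using Picard_residuals_tendsto_0[OF kannan assms(2)] False by blast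
    from LIMSEQ_subseq_LIMSEQ[OF this assms(8)]
    have "(\<lambda>k. dist (T (x (r k))) (S (x (r k)))) \<longlonglongrightarrow> 0"
      by (simp add: o_def)
    from coincidence_if_S_fixes_limit[OF kannan this assms(9) \<open>S (S q) = S q\<close>] False
    show False
      by blast
  qed
  ultimately show ?thesis
    by blast
qed

end
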